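(* Let $q$ be a constant power of $2$, let $t,h,\ell,n$ be positive integers, and put $\lambda=\frac{\ell}{n}$ and $\eta=\frac{\log_q h}{n}$. Assume that $\lambda$ is between $0$ and $1-1/q$ and bounded away from both. Let $\mathcal{G}=\mathcal{G}_{(t,h,\ell)}$ be the graph of $(t,h,\ell)$-sets in $\mathbb{F}_q^n$ and $\mathcal{G}^2$ its square (both defined in the context), and let $\chi$ denote the chromatic number. If $n,h\to\infty$, then $$\frac{\log_q\chi(\mathcal{G}^2)}{tnh}\;\ge\; H_q\!\left(\frac{\lambda}{2}\right)-\eta+o(1),$$ $$\frac{\log_q\chi(\mathcal{G}^2)}{tnh}\;\le\; 2\left(H_q(\lambda)-\eta\right)+o(1),$$ where for the upper bound it is also required that $\eta<H_q(\lambda)-\epsilon$ for some positive $\epsilon$.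
   Context: $H_q(x)=-x\log_q x-(1-x)\log_q(1-x)+x\log_q(q-1)$ is the $q$-ary entropy function. For $\mathbf{x},\mathbf{y}\in\mathbb{F}_q^n$, $d_H(\mathbf{x},\mathbf{y})$ is the Hamming distance. For $S^A,S^B\subseteq\mathbb{F}_q^n$, the pair $(S^A,S^B)$ are called $(t,h,\ell)$-sets if the symmetric difference can be written as $S^A\bigtriangleup S^B=\bigcup_{i=1}^{j}\{\mathbf{x}_{i,1},\dots,\mathbf{x}_{i,k_i}\}$ with $j\le t$, $k_i\le h$ for all $1\le i\le j$, and $d_H(\mathbf{u},\mathbf{w})\le\ell$ for any $\mathbf{u},\mathbf{w}$ in the same set $\{\mathbf{x}_{i,1},\dots,\mathbf{x}_{i,k_i}\}$. The undirected graph $\mathcal{G}_{(t,h,\ell)}$ has as vertices all $2^{q^n}$ subsets of $\mathbb{F}_q^n$; two distinct vertices are joined by an edge if and only if they are $(t,h,\ell)$-sets. The square $\mathcal{G}^2$ of a graph $\mathcal{G}$ has the same vertex set, with two vertices adjacent if and only if their distance in $\mathcal{G}$ is $1$ or $2$. *)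

theory Defs
  imports Complex_Main "HOL-Library.Cardinality" "HOL-Library.Extended_Nat" "HOL-Library.Landau_Symbols"
begin

definition qary_entropy :: "real \<Rightarrow> real \<Rightarrow> real" where
  "qary_entropy q x = - x * log q x - (1 - x) * log q (1 - x) + x * log q (q - 1)"

text \<open>The space of words of length \<open>n\<close> over \<open>'a\<close>; it is \<open>F\<^sub>q\<^sup>n\<close> when \<open>'a\<close> is a field
  with \<open>q\<close> elements.\<close>

definition words :: "nat \<Rightarrow> 'a list set" where
  "words n = {xs. length xs = n}"

text \<open>Only used for words of equal length.\<close>

definition hamming_dist :: "'a list \<Rightarrow> 'a list \<Rightarrow> nat" where
  "hamming_dist xs ys = card {i. i < length xs \<and> xs ! i \<noteq> ys ! i}"

definition thl_sets :: "nat \<Rightarrow> nat \<Rightarrow> nat \<Rightarrow> 'a list set \<Rightarrow> 'a list set \<Rightarrow> bool" where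
  "thl_sets t h l A B \<longleftrightarrow>
     (\<exists>j X. j \<le> t \<and> (A - B) \<union> (B - A) = (\<Union>i<j. X i) \<and>
        (\<forall>i<j. finite (X i) \<and> card (X i) \<le> h \<and>
               (\<forall>u\<in>X i. \<forall>w\<in>X i. hamming_dist u w \<le> l)))"

text \<open>An undirected graph is a vertex set together with a symmetric, irreflexive
  adjacency relation on it.\<close>

type_synonym 'v graph = "'v set \<times> 'v rel"

text \<open>Minimal length of a walk, \<open>\<infinity>\<close> between different components.\<close>

definition graph_dist :: "'v graph \<Rightarrow> 'v \<Rightarrow> 'v \<Rightarrow> enat" where
  "graph_dist G u v = (INF k\<in>{k. (u, v) \<in> snd G ^^ k}. enat k)"

definition graph_square :: "'v graph \<Rightarrow> 'v graph" where
  "graph_square G =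
     (fst G, {(u, v). u \<in> fst G \<and> v \<in> fst G \<and> graph_dist G u v \<in> {1, 2}})"

definition proper_colouring :: "'v graph \<Rightarrow> nat \<Rightarrow> ('v \<Rightarrow> nat) \<Rightarrow> bool" where
  "proper_colouring G k c \<longleftrightarrow>
     (\<forall>v\<in>fst G. c v < k) \<and> (\<forall>(u, v)\<in>snd G. c u \<noteq> c v)"

text \<open>Meaningful for graphs with finitely many vertices, where a colouring exists.\<close>

definition chromatic_number :: "'v graph \<Rightarrow> nat" where
  "chromatic_number G = (LEAST k. \<exists>c. proper_colouring G k c)"

definition thl_graph :: "nat \<Rightarrow> nat \<Rightarrow> nat \<Rightarrow> nat \<Rightarrow> 'a list set graph" where
  "thl_graph n t h l =
     (Pow (words n),
      {(A, B). A \<subseteq> words n \<and> B \<subseteq> words n \<and> A \<noteq> B \<and> thl_sets t h l A B})"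

end

theory Submission
  imports Defs "HOL-Library.FuncSet"
begin

text \<open>Lower bound: if \<open>V\<close> is the size of a Hamming ball of radius \<open>l div 2\<close>, the subsets of this ball
  with \<open>t h\<close> elements are neighbours of the empty set and hence form a clique in the square, so
  \<open>\<chi> \<ge> (V / (t h))\<^sup>t\<^sup>h\<close>; since \<open>V \<ge> q powr (n (H(l / (2n)) - o(1)))\<close> the bound follows, the factor \<open>t\<close>
  being absorbed because it is constant.

  Upper bound: greedy colouring gives \<open>\<chi> \<le> N\<^sup>2\<close>, where \<open>N\<close> counts the possible symmetric
  differences. A cluster is a set of at most \<open>h\<close> points in the ball of radius \<open>l\<close> around one of its
  points, so \<open>N \<le> (q\<^sup>n (e W / h)\<^sup>h)\<^sup>t\<close> with \<open>W = q powr (n H(l / n))\<close>, which bounds the size of the ball.\<close>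

section \<open>Hamming distance and the sizes of spheres and balls\<close>

lemma words_0 [simp]: "words 0 = {[]}"
  by (auto simp: words_def)

lemma finite_words [simp]: "finite (words n :: 'a::finite list set)"
  and card_words: "card (words n :: 'a::finite list set) = CARD('a) ^ n"
  using finite_lists_length_eq[of "UNIV :: 'a set" n] card_lists_length_eq[of "UNIV :: 'a set" n]
  by (simp_all add: words_def)

lemma hamming_dist_Cons:
  "hamming_dist (a # xs) (b # ys) = (if a = b then 0 else 1) + hamming_dist xs ys"
proof -
  have "{i. i < length (a # xs) \<and> (a # xs) ! i \<noteq> (b # ys) ! i}
      = (if a = b then {} else {0}) \<union> Suc ` {i. i < length xs \<and> xs ! i \<noteq> ys ! i}"
  proof (rule set_eqI)
    fix j
    show "j \<in> {i. i < length (a # xs) \<and> (a # xs) ! i \<noteq> (b # ys) ! i} \<longleftrightarrow>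
      j \<in> (if a = b then {} else {0}) \<union> Suc ` {i. i < length xs \<and> xs ! i \<noteq> ys ! i}"
      by (cases j) auto
  qed
  then have "hamming_dist (a # xs) (b # ys)
      = card ((if a = b then {} else {0}) \<union> Suc ` {i. i < length xs \<and> xs ! i \<noteq> ys ! i})"
    unfolding hamming_dist_def by (rule arg_cong)
  also have "\<dots> = card (if a = b then {} else {0::nat}) + card (Suc ` {i. i < length xs \<and> xs ! i \<noteq> ys ! i})"
    by (rule card_Un_disjoint) auto
  finally show ?thesis
    by (simp add: card_image hamming_dist_def)
qed

text \<open>Where \<open>u\<close> and \<open>w\<close> differ, \<open>x\<close> differs from one of
  them. \<open>hamming_dist\<close> takes its index range from its first argument, so equal lengths
  of \<open>u\<close> and \<open>x\<close> align the ranges.\<close>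

lemma hamming_dist_triangle:
  assumes "length u = length x"
  shows "hamming_dist u w \<le> hamming_dist x u + hamming_dist x w"
proof -
  have "hamming_dist u w \<le> card ({i. i < length x \<and> x ! i \<noteq> u ! i} \<union> {i. i < length x \<and> x ! i \<noteq> w ! i})"
    unfolding hamming_dist_def using assms by (intro card_mono) auto
  also have "\<dots> \<le> hamming_dist x u + hamming_dist x w"
    unfolding hamming_dist_def by (rule card_Un_le)
  finally show ?thesis .
qed

definition hamming_sphere :: "'a list \<Rightarrow> nat \<Rightarrow> 'a list set" where
  "hamming_sphere x i = {w \<in> words (length x). hamming_dist x w = i}"

definition hamming_ball :: "'a list \<Rightarrow> nat \<Rightarrow> 'a list set" where
  "hamming_ball x r = {w \<in> words (length x). hamming_dist x w \<le> r}"

lemma finite_hamming_sphere [simp]: "finite (hamming_sphere (x :: 'a::finite list) i)"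
  by (simp add: hamming_sphere_def)

lemma finite_hamming_ball [simp]: "finite (hamming_ball (x :: 'a::finite list) i)"
  by (simp add: hamming_ball_def)

text \<open>Either the first letter stays \<open>a\<close> and all changes lie in the tail, or it
  changes and the tail has one change fewer. The two cases are disjoint, which gives Pascal's rule
  for the sizes.\<close>

lemma hamming_sphere_Cons:
  "hamming_sphere (a # x) i = (#) a ` hamming_sphere x i \<union>
     (case i of 0 \<Rightarrow> {} | Suc k \<Rightarrow> (\<lambda>(b, w). b # w) ` ((UNIV - {a}) \<times> hamming_sphere x k))"
  (is "_ = ?R")
proof (rule set_eqI)
  fix w
  show "w \<in> hamming_sphere (a # x) i \<longleftrightarrow> w \<in> ?R"
  proof (cases w)
    case Nil
    show ?thesis
      unfolding Nil by (cases i) (auto simp: hamming_sphere_def words_def)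
  next
    case (Cons b v)
    have "w \<in> ?R \<longleftrightarrow> (b = a \<and> v \<in> hamming_sphere x i) \<or>
        (b \<noteq> a \<and> (\<exists>k. i = Suc k \<and> v \<in> hamming_sphere x k))"
      unfolding Cons by (cases i) auto
    also have "\<dots> \<longleftrightarrow> w \<in> hamming_sphere (a # x) i"
      unfolding Cons by (cases i) (auto simp: hamming_sphere_def words_def hamming_dist_Cons)
    finally show ?thesis by blast
  qed
qed

lemma card_hamming_sphere:
  fixes x :: "'a::finite list"
  shows "card (hamming_sphere x i) = (length x choose i) * (CARD('a) - 1) ^ i"
proof (induction x arbitrary: i)
  case Nil
  have "hamming_sphere ([] :: 'a list) i = (if i = 0 then {[]} else {})"
    by (auto simp: hamming_sphere_def hamming_dist_def)
  then show ?case by (cases i) auto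
next
  case (Cons a x)
  show ?case
  proof (cases i)
    case 0
    then show ?thesis using Cons by (simp add: hamming_sphere_Cons card_image)
  next
    case (Suc k)
    let ?Y = "(\<lambda>(b, w). b # w) ` ((UNIV - {a}) \<times> hamming_sphere x k)"
    have "card (hamming_sphere (a # x) i) = card ((#) a ` hamming_sphere x i) + card ?Y"
      unfolding hamming_sphere_Cons Suc nat.case by (rule card_Un_disjoint) auto
    also have "card ?Y = (CARD('a) - 1) * card (hamming_sphere x k)"
      by (subst card_image) (auto simp: inj_on_def card_cartesian_product)
    also have "card ((#) a ` hamming_sphere x i) = card (hamming_sphere x i)"
      by (rule card_image) simp
    finally show ?thesis
      using Suc by (simp add: Cons.IH algebra_simps)
  qed
qed

lemma card_hamming_ball:
  fixes x :: "'a::finite list"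
  shows "card (hamming_ball x r) = (\<Sum>i\<le>r. (length x choose i) * (CARD('a) - 1) ^ i)"
proof -
  have "hamming_ball x r = (\<Union>i\<le>r. hamming_sphere x i)"
    by (auto simp: hamming_ball_def hamming_sphere_def)
  moreover have "card (\<Union>i\<le>r. hamming_sphere x i) = (\<Sum>i\<le>r. card (hamming_sphere x i))"
    by (rule card_UN_disjoint) (auto simp: hamming_sphere_def)
  ultimately show ?thesis
    by (simp add: card_hamming_sphere)
qed

section \<open>Entropy estimates for the size of a Hamming ball\<close>

text \<open>With \<open>z = p / ((1 - p) (q - 1))\<close>, the binomial weight \<open>(n choose i) p\<^sup>i (1 - p)\<^sup>n\<^sup>-\<^sup>i\<close> is
  \<open>(1 - p)\<^sup>n z\<^sup>i\<close> times the size of the Hamming sphere of radius \<open>i\<close>.\<close>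

lemma entropy_eq:
  fixes p q :: real
  assumes "0 < p" "p < 1" "1 < q"
  shows "qary_entropy q p = - log q (1 - p) - p * log q (p / ((1 - p) * (q - 1)))"
proof -
  have "log q (p / ((1 - p) * (q - 1))) = log q p - (log q (1 - p) + log q (q - 1))"
    using assms by (simp add: log_divide log_mult)
  then show ?thesis
    by (simp only: qary_entropy_def) (simp add: algebra_simps)
qed

text \<open>A Chernoff-type argument: for \<open>z \<le> 1\<close> the factor \<open>z ^ l\<close>
  is at most \<open>z ^ i\<close> on each sphere of radius \<open>i \<le> l\<close>, and the
  binomial theorem sums the weights \<open>z ^ i\<close> over the whole space. The hypothesis
  \<open>p \<le> 1 - 1 / q\<close> amounts to \<open>z \<le> 1\<close>.\<close>

lemma card_hamming_ball_le:
  fixes x :: "'a::finite list" and q :: real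
  assumes q: "q = real CARD('a)" "2 \<le> q" and n: "length x = n" "0 < n"
    and p: "p = real l / real n" "0 < p" "p \<le> 1 - 1 / q"
  shows "real (card (hamming_ball x l)) \<le> q powr (real n * qary_entropy q p)"
proof -
  have "0 < 1 / q" using q(2) by simp
  then have p1: "p < 1" using p(3) by linarith
  define z where "z = p / ((1 - p) * (q - 1))"
  have z0: "0 < z" using p(2) p1 q(2) by (simp add: z_def)
  have "p * q \<le> q - 1" using p(3) q(2) by (simp add: field_simps)
  then have "p \<le> (1 - p) * (q - 1)" by (simp add: algebra_simps)
  then have z1: "z \<le> 1" using p1 q(2) by (simp add: z_def)
  have "real n * p \<le> real n * 1" using p1 by (intro mult_left_mono) auto
  then have ln: "l \<le> n" using p(1) n by simp
  have "real (card (hamming_ball x l)) * z ^ l = (\<Sum>i\<le>l. real (n choose i) * (q - 1) ^ i * z ^ l)"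
    by (simp add: card_hamming_ball n q(1)[symmetric] sum_distrib_right)
  also have "\<dots> \<le> (\<Sum>i\<le>l. real (n choose i) * (q - 1) ^ i * z ^ i)"
    using q(2) z0 z1 by (intro sum_mono mult_left_mono power_decreasing) auto
  also have "\<dots> \<le> (\<Sum>i\<le>n. real (n choose i) * (q - 1) ^ i * z ^ i)"
    using q(2) z0 ln by (intro sum_mono2) auto
  also have "\<dots> = ((q - 1) * z + 1) ^ n"
    by (simp add: binomial_ring power_mult_distrib mult_ac)
  also have "(q - 1) * z + 1 = 1 / (1 - p)"
    using p1 q(2) by (simp add: z_def divide_simps)
  finally have "real (card (hamming_ball x l)) \<le> (1 / (1 - p)) ^ n / z ^ l"
    using z0 by (simp add: pos_le_divide_eq)
  also have "\<dots> = q powr log q ((1 / (1 - p)) ^ n / z ^ l)"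
    using z0 p1 q(2) by (intro powr_log_cancel[symmetric]) auto
  \<comment> \<open>Since \<open>l = n p\<close>, this is \<open>n\<close> times the right-hand side
    of \<open>entropy_eq\<close>, without loss.\<close>
  also have "log q ((1 / (1 - p)) ^ n / z ^ l) = real n * qary_entropy q p"
  proof -
    have ent: "qary_entropy q p = - log q (1 - p) - p * log q z"
      unfolding z_def using p(2) p1 q(2) by (intro entropy_eq) auto
    have "log q ((1 / (1 - p)) ^ n / z ^ l) = - real n * log q (1 - p) - real l * log q z"
      using z0 p1 q(2) by (simp add: log_divide log_nat_power)
    also have "real l = real n * p" using p(1) n by simp
    finally show ?thesis
      by (simp add: ent algebra_simps)
  qed
  finally show ?thesis .
qed

text \<open>The two inequalities place \<open>r\<close> at the mode of the binomial distribution
  with parameters \<open>n\<close> and \<open>p\<close>; the largest of \<open>n + 1\<close> weights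
  with sum 1 is at least \<open>1 / (n + 1)\<close>.\<close>

lemma binomial_mode:
  fixes p :: real
  assumes p: "0 < p" "p < 1" and r: "real r \<le> real n * p" "real n * p + p \<le> real r + 1"
  shows "1 \<le> (real n + 1) * (real (n choose r) * p ^ r * (1 - p) ^ (n - r))"
proof -
  define a where "a i = real (n choose i) * p ^ i * (1 - p) ^ (n - i)" for i
  \<comment> \<open>The ratio of consecutive weights, with denominators cleared.\<close>
  have step: "(real i + 1) * (1 - p) * a (Suc i) = (real n - real i) * p * a i" if "i < n" for i
  proof -
    have "n - i = Suc (n - Suc i)" using that by simp
    moreover have "(real i + 1) * real (n choose Suc i) = (real n - real i) * real (n choose i)"
    proof -
      have "Suc i * (n choose Suc i) = (n - i) * (n choose i)"
        using binomial_absorption[of i n] binomial_absorb_comp[of n i] by simp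
      then have "real (Suc i * (n choose Suc i)) = real ((n - i) * (n choose i))" by simp
      then show ?thesis using that by (simp add: of_nat_diff algebra_simps)
    qed
    moreover have "(real i + 1) * (1 - p) * (real (n choose Suc i) * p ^ Suc i * (1 - p) ^ (n - Suc i))
      = ((real i + 1) * real (n choose Suc i)) * p * p ^ i * (1 - p) ^ Suc (n - Suc i)"
      by (simp only: power_Suc mult_ac)
    ultimately show ?thesis
      unfolding a_def by (simp only: mult_ac)
  qed
  have a0: "0 \<le> a i" for i using p by (simp add: a_def)
  have "real n * p \<le> real n * 1" using p by (intro mult_left_mono) auto
  then have rn: "r \<le> n" using r(1) by linarith
  \<comment> \<open>Weights do not decrease as long as \<open>i + 1 \<le> (n + 1) p\<close>, which
    \<open>i < r\<close> implies.\<close>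
  have up: "a i \<le> a (Suc i)" if "i < r" for i
  proof -
    have "i < n" using that rn by simp
    have "(real i + 1) \<le> real n * p" using that r by linarith
    then have "(real i + 1) * (1 - p) \<le> (real n - real i) * p" using p by (simp add: algebra_simps)
    then have "(real i + 1) * (1 - p) * a i \<le> (real i + 1) * (1 - p) * a (Suc i)"
      unfolding step[OF \<open>i < n\<close>] using a0 by (intro mult_right_mono)
    then show ?thesis using p by (simp add: mult_le_cancel_left_pos)
  qed
  \<comment> \<open>Conversely, \<open>r \<le> i\<close> forces
    \<open>(n + 1) p \<le> i + 1\<close>.\<close>
  have down: "a (Suc i) \<le> a i" if "r \<le> i" "i < n" for i
  proof -
    have "real n * p + p \<le> (real i + 1)" using that r by linarith
    then have "(real n - real i) * p \<le> (real i + 1) * (1 - p)" by (simp add: algebra_simps)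
    then have "(real i + 1) * (1 - p) * a (Suc i) \<le> (real i + 1) * (1 - p) * a i"
      unfolding step[OF \<open>i < n\<close>] using a0 by (intro mult_right_mono)
    then show ?thesis using p by (simp add: mult_le_cancel_left_pos)
  qed
  have le: "a i \<le> a r" if "i \<le> n" for i
  proof (cases "i \<le> r")
    case True
    then show ?thesis
      by (induction i rule: inc_induct) (auto intro: order.trans up)
  next
    case False
    then have "r \<le> i" by simp
    then show ?thesis using that
      by (induction i rule: dec_induct) (auto intro: order.trans[OF down])
  qed
  have "1 = (p + (1 - p)) ^ n" by simp
  also have "\<dots> = (\<Sum>i\<le>n. a i)" by (subst binomial_ring) (simp add: a_def)
  also have "\<dots> \<le> (\<Sum>i\<le>n. a r)" using le by (intro sum_mono) auto
  finally show ?thesis by (simp add: a_def add.commute)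
qed

text \<open>The outermost sphere suffices: its radius is a mode of the binomial distribution with
  \<open>p = l / (2 n)\<close>, so its weight is at least \<open>1 / (n + 1)\<close>. The term
  \<open>log q (p / q)\<close> pays for rounding \<open>l / 2\<close> down.\<close>

lemma log_card_hamming_ball_ge:
  fixes x :: "'a::finite list" and q :: real
  assumes q: "q = real CARD('a)" "2 \<le> q" and n: "length x = n" "0 < n"
    and p: "p = real l / (2 * real n)" "0 < p" "p \<le> 1 / 2"
  shows "log q (card (hamming_ball x (l div 2)))
    \<ge> real n * qary_entropy q p + log q (p / q) - log q (real n + 1)"
proof -
  define r where "r = l div 2"
  have rl: "2 * real r \<le> real l" "real l \<le> 2 * real r + 1"
    unfolding r_def by linarith+
  have np: "real n * p = real l / 2" using p(1) n by simp
  \<comment> \<open>Rounding loses at most 1/2; with \<open>p \<le> 1 / 2\<close> this yields the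
    second mode condition \<open>n p + p \<le> r + 1\<close>.\<close>
  have r: "real r \<le> real n * p" "real n * p \<le> real r + 1 / 2" using rl unfolding np by simp_all
  have "real n * p \<le> real n * 1" using p(3) by (intro mult_left_mono) auto
  then have rn: "r \<le> n" using r(1) by linarith
  define z where "z = p / ((1 - p) * (q - 1))"
  have z0: "0 < z" using p(2,3) q(2) by (simp add: z_def)
  have "p \<le> (1 - p) * (q - 1)" using p(3) q(2) mult_mono[of "1/2" "1-p" 1 "q-1"] by simp
  then have z1: "z \<le> 1" using p(2,3) q(2) by (simp add: z_def)
  have zp: "p / q \<le> z"
  proof -
    have "(1 - p) * (q - 1) \<le> 1 * q" using p(2,3) q(2) by (intro mult_mono) auto
    then show ?thesis unfolding z_def using p(2,3) q(2) by (intro divide_left_mono) auto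
  qed
  define s where "s = real (n choose r) * (q - 1) ^ r"
  have s0: "0 < s" using rn q(2) by (simp add: s_def)
  have "real (card (hamming_sphere x r)) = s"
    by (simp add: card_hamming_sphere n q(1)[symmetric] s_def)
  moreover have "card (hamming_sphere x r) \<le> card (hamming_ball x r)"
    by (intro card_mono) (auto simp: hamming_ball_def hamming_sphere_def)
  ultimately have sb: "s \<le> real (card (hamming_ball x r))" by simp
  have "real (n choose r) * p ^ r * (1 - p) ^ (n - r) = s * z ^ r * (1 - p) ^ n"
    using p(2,3) q(2) rn by (simp add: s_def z_def power_divide power_mult_distrib power_diff)
  then have "1 \<le> (real n + 1) * (s * z ^ r * (1 - p) ^ n)"
    using binomial_mode[of p r n] p(2,3) r by simp
  then have "log q 1 \<le> log q ((real n + 1) * (s * z ^ r * (1 - p) ^ n))"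
    using q(2) by (intro log_mono) auto
  also have "\<dots> = log q (real n + 1) + log q s + real r * log q z + real n * log q (1 - p)"
    using s0 z0 p(2,3) q(2) by (simp add: log_mult log_nat_power)
  finally have "log q s \<ge> - real n * log q (1 - p) - real r * log q z - log q (real n + 1)" by simp
  \<comment> \<open>The entropy has \<open>n p\<close> where \<open>r\<close> stands; the last
    summand is the discrepancy.\<close>
  moreover have "- real n * log q (1 - p) - real r * log q z
      = real n * qary_entropy q p + (real n * p - real r) * log q z"
  proof -
    have ent: "qary_entropy q p = - log q (1 - p) - p * log q z"
      unfolding z_def using p(2,3) q(2) by (intro entropy_eq) auto
    show ?thesis by (simp add: ent algebra_simps)
  qed
  \<comment> \<open>As \<open>log q z \<le> 0\<close> and \<open>n p - r \<le> 1\<close>, the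
    discrepancy is at worst \<open>log q z\<close>.\<close>
  moreover have "(real n * p - real r) * log q z \<ge> 1 * log q z"
    using z0 z1 r q(2) by (intro mult_right_mono_neg) (auto simp: log_le_zero_cancel_iff)
  moreover have "log q (p / q) \<le> log q z"
    using zp p(2,3) q(2) by (intro log_mono) auto
  moreover have "log q s \<le> log q (card (hamming_ball x r))"
    using sb s0 q(2) by (intro log_mono) auto
  ultimately show ?thesis unfolding r_def by linarith
qed

section \<open>Squares of graphs, greedy colouring and cliques\<close>

text \<open>Distance 1 or 2 means that there is a walk of length 1 or 2 but none of length 0, so the
  infimum in \<open>graph_dist\<close> gives way to a relational composition.\<close>

lemma graph_square_iff:
  assumes "u \<in> fst G" "v \<in> fst G"
  shows "(u, v) \<in> snd (graph_square G) \<longleftrightarrow> u \<noteq> v \<and> (u, v) \<in> snd G \<union> snd G O snd G"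
proof -
  define K where "K = {k. (u, v) \<in> snd G ^^ k}"
  have dist: "graph_dist G u v = Inf (enat ` K)"
    by (simp add: graph_dist_def K_def)
  have adj: "(u, v) \<in> snd (graph_square G) \<longleftrightarrow> graph_dist G u v \<in> {1, 2}"
    using assms by (simp add: graph_square_def)
  have K: "0 \<in> K \<longleftrightarrow> u = v" "1 \<in> K \<longleftrightarrow> (u, v) \<in> snd G" "2 \<in> K \<longleftrightarrow> (u, v) \<in> snd G O snd G"
    by (auto simp: K_def numeral_2_eq_2)
  show ?thesis
  proof (cases "K = {}")
    \<comment> \<open>Without any walk the infimum is \<open>\<infinity>\<close>, and both sides
      fail.\<close>
    case True
    then show ?thesis using K unfolding adj dist by (simp add: Inf_enat_def)
  next
    case False
    define k where "k = (LEAST k. k \<in> K)"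
    have k: "k \<in> K" "\<And>i. i \<in> K \<Longrightarrow> k \<le> i"
      using False unfolding k_def by (auto intro: LeastI Least_le)
    have "Inf (enat ` K) = enat k"
      using k by (intro antisym INF_greatest INF_lower) auto
    then have "graph_dist G u v \<in> {1, 2} \<longleftrightarrow> k = 1 \<or> k = 2"
      unfolding dist by (simp add: one_enat_def numeral_eq_enat)
    also have "\<dots> \<longleftrightarrow> 0 \<notin> K \<and> (1 \<in> K \<or> 2 \<in> K)"
    proof
      assume "k = 1 \<or> k = 2"
      then show "0 \<notin> K \<and> (1 \<in> K \<or> 2 \<in> K)" using k by force
    next
      assume a: "0 \<notin> K \<and> (1 \<in> K \<or> 2 \<in> K)"
      then have "k \<noteq> 0" using k(1) by metis
      moreover have "k \<le> 2" using a k(2) by fastforce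
      ultimately show "k = 1 \<or> k = 2" by linarith
    qed
    finally show ?thesis using K adj by simp
  qed
qed

text \<open>Vertices are coloured one at a time: fewer than \<open>D\<close> neighbours cannot block
  all \<open>D\<close> colours.\<close>

lemma greedy_colouring:
  assumes V: "finite V" and E: "sym E" "irrefl E" "E \<subseteq> V \<times> V"
    and deg: "\<And>v. v \<in> V \<Longrightarrow> card (E `` {v}) < D"
  shows "\<exists>c. proper_colouring (V, E) D c"
proof -
  \<comment> \<open>The induction runs over subsets \<open>U\<close> of \<open>V\<close>, with
    properness demanded only inside \<open>U\<close>.\<close>
  have "\<exists>c. (\<forall>v\<in>U. c v < D) \<and> (\<forall>u\<in>U. \<forall>v\<in>U. (u, v) \<in> E \<longrightarrow> c u \<noteq> c v)" if "U \<subseteq> V" for U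
    using finite_subset[OF that V] that
  proof (induction U rule: finite_induct)
    case empty
    then show ?case by simp
  next
    case (insert x U)
    then obtain c where c: "\<forall>v\<in>U. c v < D" "\<forall>u\<in>U. \<forall>v\<in>U. (u, v) \<in> E \<longrightarrow> c u \<noteq> c v"
      by auto
    have "finite (E `` {x})"
      by (rule finite_subset[OF _ V]) (use E in auto)
    then have "card (c ` (E `` {x})) < card {..<D}"
      using deg[of x] insert.prems card_image_le[of "E `` {x}" c] by simp
    then have "\<not> {..<D} \<subseteq> c ` (E `` {x})"
      by (meson card_mono finite_imageI \<open>finite (E `` {x})\<close> not_le)
    \<comment> \<open>\<open>k\<close> avoids the values of \<open>c\<close> on all neighbours of
      \<open>x\<close>, even those outside \<open>U\<close>; the degree bound covers them
      all.\<close>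
    then obtain k where k: "k < D" "k \<notin> c ` (E `` {x})" by auto
    have "\<forall>v\<in>insert x U. (c(x := k)) v < D" using c k by simp
    moreover have "(c(x := k)) u \<noteq> (c(x := k)) v"
      if uv: "u \<in> insert x U" "v \<in> insert x U" "(u, v) \<in> E" for u v
    proof -
      have "u \<noteq> v" using uv E by (auto simp: irrefl_def)
      moreover have "(v, u) \<in> E" using uv E by (auto dest: symD)
      ultimately show ?thesis using uv c k by (cases "u = x"; cases "v = x") auto
    qed
    ultimately show ?case by (intro exI[of _ "c(x := k)"]) blast
  qed
  from this[of V] obtain c where "\<forall>v\<in>V. c v < D" "\<forall>u\<in>V. \<forall>v\<in>V. (u, v) \<in> E \<longrightarrow> c u \<noteq> c v"
    by auto
  then show ?thesis
    using E unfolding proper_colouring_def by (intro exI[of _ c]) auto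
qed

lemma chromatic_number_le: "proper_colouring G k c \<Longrightarrow> chromatic_number G \<le> k"
  unfolding chromatic_number_def by (rule Least_le) blast

text \<open>A proper colouring is injective on a clique. The given \<open>c\<close> ensures that the
  \<open>LEAST\<close> in \<open>chromatic_number\<close> is attained.\<close>

lemma clique_le_chromatic_number:
  assumes "proper_colouring G k c" and "C \<subseteq> fst G"
    and clique: "\<And>u v. u \<in> C \<Longrightarrow> v \<in> C \<Longrightarrow> u \<noteq> v \<Longrightarrow> (u, v) \<in> snd G"
  shows "card C \<le> chromatic_number G"
proof -
  have "\<exists>c. proper_colouring G (chromatic_number G) c"
    unfolding chromatic_number_def by (rule LeastI[of _ k]) (use assms in blast)
  then obtain d where d: "proper_colouring G (chromatic_number G) d" by blast
  have "inj_on d C"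
    using d clique unfolding proper_colouring_def inj_on_def by blast
  moreover have "d ` C \<subseteq> {..<chromatic_number G}"
    using d assms(2) by (auto simp: proper_colouring_def)
  ultimately show ?thesis
    using card_inj_on_le[of d C "{..<chromatic_number G}"] by simp
qed

section \<open>Counting the symmetric differences of adjacent vertices, and colouring the
  square\<close>

definition clusters :: "nat \<Rightarrow> nat \<Rightarrow> nat \<Rightarrow> 'a list set set" where
  "clusters n h l = {X. X \<subseteq> words n \<and> card X \<le> h \<and> (\<forall>u\<in>X. \<forall>w\<in>X. hamming_dist u w \<le> l)}"

text \<open>The symmetric difference of \<open>{}\<close> and \<open>D\<close> is \<open>D\<close>,
  so \<open>thl_sets\<close> with first argument \<open>{}\<close> is a condition on the difference
  alone.\<close>

definition thl_differences :: "nat \<Rightarrow> nat \<Rightarrow> nat \<Rightarrow> nat \<Rightarrow> 'a list set set" where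
  "thl_differences n t h l = {D. D \<subseteq> words n \<and> thl_sets t h l {} D}"

text \<open>This makes the graph a Cayley graph of the group of subsets under symmetric
  difference.\<close>

lemma thl_sets_sym_diff: "thl_sets t h l A B \<longleftrightarrow> thl_sets t h l {} ((A - B) \<union> (B - A))"
  by (simp add: thl_sets_def)

lemma thl_sets_commute: "thl_sets t h l A B \<longleftrightarrow> thl_sets t h l B A"
  by (simp add: thl_sets_def Un_commute)

lemma empty_in_thl_differences: "{} \<in> thl_differences n t h l"
  unfolding thl_differences_def thl_sets_def by (auto intro!: exI[of _ 0])

lemma finite_clusters [simp]: "finite (clusters n h l :: 'a::finite list set set)"
  by (rule finite_subset[of _ "Pow (words n)"]) (auto simp: clusters_def)

lemma finite_thl_differences [simp]: "finite (thl_differences n t h l :: 'a::finite list set set)"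
  by (rule finite_subset[of _ "Pow (words n)"]) (auto simp: thl_differences_def)

text \<open>A difference is determined by a \<open>t\<close>-tuple of clusters whose union it
  is.\<close>

lemma card_thl_differences_le:
  "card (thl_differences n t h l :: 'a::finite list set set)
    \<le> card (clusters n h l :: 'a list set set) ^ t"
proof -
  let ?P = "{..<t} \<rightarrow>\<^sub>E (clusters n h l :: 'a list set set)"
  have "thl_differences n t h l \<subseteq> (\<lambda>X. \<Union>i<t. X i) ` ?P"
  proof
    fix D :: "'a list set"
    assume "D \<in> thl_differences n t h l"
    then obtain j X where D: "D \<subseteq> words n" and j: "j \<le> t" and X: "D = (\<Union>i<j. X i)"
      "\<And>i. i < j \<Longrightarrow> card (X i) \<le> h" "\<And>i. i < j \<Longrightarrow> \<forall>u\<in>X i. \<forall>w\<in>X i. hamming_dist u w \<le> l"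
      by (auto simp: thl_differences_def thl_sets_def)
    \<comment> \<open>Empty sets pad the \<open>j\<close> clusters to \<open>t\<close>;
      \<open>restrict\<close> puts the tuple into the extensional function space, whose size is a
      power.\<close>
    define Y where "Y = restrict (\<lambda>i. if i < j then X i else {}) {..<t}"
    have "X i \<in> clusters n h l" if "i < j" for i
      using that D X by (auto simp: clusters_def)
    moreover have "{} \<in> clusters n h l" by (simp add: clusters_def)
    ultimately have "Y \<in> ?P" by (auto simp: Y_def)
    moreover have "D = (\<Union>i<t. Y i)"
      using j unfolding X(1) Y_def by (fastforce split: if_splits)
    ultimately show "D \<in> (\<lambda>X. \<Union>i<t. X i) ` ?P" by blast
  qed
  then have "card (thl_differences n t h l :: 'a list set set) \<le> card ?P"
    by (intro surj_card_le) (auto intro: finite_PiE)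
  also have "\<dots> = card (clusters n h l :: 'a list set set) ^ t"
    by (simp add: card_PiE)
  finally show ?thesis .
qed

text \<open>Every vertex within two steps of \<open>A\<close> arises by adding two differences in
  turn, which leaves at most \<open>(card ?D)\<^sup>2\<close> of them. \<open>A\<close> is among
  them, so its degree is strictly smaller, as greedy colouring requires.\<close>

lemma square_thl_graph_colouring:
  "\<exists>c. proper_colouring (graph_square (thl_graph n t h l :: 'a::finite list set graph))
         ((card (thl_differences n t h l :: 'a list set set))\<^sup>2) c"
proof -
  let ?G = "thl_graph n t h l :: 'a list set graph"
  let ?D = "thl_differences n t h l :: 'a list set set"
  define V where "V = (Pow (words n) :: 'a list set set)"
  define E where "E = snd (graph_square ?G)"
  \<comment> \<open>\<open>N A\<close>, the translate of the set of differences by \<open>A\<close>,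
    contains \<open>A\<close> and all its neighbours.\<close>
  define N where "N A = (\<lambda>X. (A - X) \<union> (X - A)) ` ?D" for A
  have GE: "graph_square ?G = (V, E)"
    by (simp add: E_def V_def graph_square_def thl_graph_def)
  have fV: "fst ?G = V" by (simp add: V_def thl_graph_def)
  have EV: "E \<subseteq> V \<times> V" by (auto simp: E_def graph_square_def fV)
  have E_iff: "(A, B) \<in> E \<longleftrightarrow> A \<noteq> B \<and> (A, B) \<in> snd ?G \<union> snd ?G O snd ?G" if "A \<in> V" "B \<in> V" for A B
    unfolding E_def using that graph_square_iff[of A ?G B] fV by simp
  have symG: "sym (snd ?G)" by (auto simp: sym_def thl_graph_def thl_sets_commute)
  have GN: "B \<in> N A" if "(A, B) \<in> snd ?G" for A B
  proof -
    have "(A - B) \<union> (B - A) \<in> ?D"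
      using that thl_sets_sym_diff[of t h l A B] by (auto simp: thl_graph_def thl_differences_def)
    \<comment> \<open>Symmetric difference with \<open>A\<close> is an involution.\<close>
    moreover have "B = (A - ((A - B) \<union> (B - A))) \<union> (((A - B) \<union> (B - A)) - A)" by auto
    ultimately show ?thesis unfolding N_def by blast
  qed
  have NA: "A \<in> N A" for A
    using empty_in_thl_differences[of n t h l] by (force simp: N_def)
  have fN: "finite (N A)" and cN: "card (N A) \<le> card ?D" for A
    by (auto simp: N_def card_image_le)
  have deg: "card (E `` {A}) < (card ?D)\<^sup>2" if "A \<in> V" for A
  proof -
    have "E `` {A} \<subset> (\<Union>B\<in>N A. N B)"
    proof
      have "A \<in> (\<Union>B\<in>N A. N B)" using NA by blast
      moreover have "A \<notin> E `` {A}" using E_iff that by auto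
      ultimately show "E `` {A} \<noteq> (\<Union>B\<in>N A. N B)" by blast
    next
      show "E `` {A} \<subseteq> (\<Union>B\<in>N A. N B)"
      proof
        fix C assume "C \<in> E `` {A}"
        then have "(A, C) \<in> E" by simp
        then have "(A, C) \<in> snd ?G \<union> snd ?G O snd ?G" using E_iff EV by blast
        then show "C \<in> (\<Union>B\<in>N A. N B)" using GN NA by blast
      qed
    qed
    then have "card (E `` {A}) < card (\<Union>B\<in>N A. N B)"
      using fN by (intro psubset_card_mono) auto
    also have "\<dots> \<le> (\<Sum>B\<in>N A. card (N B))" by (rule card_UN_le[OF fN])
    also have "\<dots> \<le> (\<Sum>B\<in>N A. card ?D)" using cN by (intro sum_mono)
    also have "\<dots> \<le> (card ?D)\<^sup>2" using cN by (simp add: power2_eq_square)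
    finally show ?thesis .
  qed
  have "sym E"
  proof (rule symI)
    fix A B assume AB: "(A, B) \<in> E"
    then have V: "A \<in> V" "B \<in> V" using EV by auto
    have "(B, A) \<in> snd ?G \<union> snd ?G O snd ?G"
      using AB E_iff[OF V] symG by (auto dest: symD)
    then show "(B, A) \<in> E" using AB E_iff V by blast
  qed
  moreover have "irrefl E"
    using E_iff EV by (auto simp: irrefl_def)
  ultimately show ?thesis
    unfolding GE using deg EV by (intro greedy_colouring) (auto simp: V_def)
qed

text \<open>As \<open>h \<le> W\<close>, each \<open>V choose k\<close> with
  \<open>k \<le> h\<close> may be multiplied by \<open>(W / h) ^ (h - k) \<ge> 1\<close>. What
  remains is part of the binomial sum
  \<open>(1 + h / W) ^ V \<le> exp (h V / W) \<le> exp h\<close>. With a bound \<open>W\<close> in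
  place of the size itself, \<open>h\<close> may exceed \<open>card B\<close>.\<close>

lemma card_subsets_le:
  fixes W :: real
  assumes B: "finite B" "real (card B) \<le> W" and h: "0 < h" "real h \<le> W"
  shows "real (card {Y. Y \<subseteq> B \<and> card Y \<le> h}) \<le> (exp 1 * W / real h) ^ h"
proof -
  define V where "V = card B"
  have W0: "0 < W" using h by linarith
  have Wh: "1 \<le> W / real h" using h by simp
  have "{Y. Y \<subseteq> B \<and> card Y \<le> h} = (\<Union>k\<le>h. {Y. Y \<subseteq> B \<and> card Y = k})" by auto
  moreover have "card (\<Union>k\<le>h. {Y. Y \<subseteq> B \<and> card Y = k}) = (\<Sum>k\<le>h. card {Y. Y \<subseteq> B \<and> card Y = k})"
    using B by (intro card_UN_disjoint) auto
  ultimately have "real (card {Y. Y \<subseteq> B \<and> card Y \<le> h}) = (\<Sum>k\<le>h. real (V choose k))"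
    using n_subsets[OF B(1)] by (simp add: V_def)
  also have "\<dots> \<le> (\<Sum>k\<le>h. (W / real h) ^ h * (real (V choose k) * (real h / W) ^ k))"
  proof (rule sum_mono)
    fix k assume "k \<in> {..h}"
    then have "(W / real h) ^ h = (W / real h) ^ (h - k) * (W / real h) ^ k"
      by (simp flip: power_add)
    then have "(W / real h) ^ h * (real h / W) ^ k = (W / real h) ^ (h - k)"
      using W0 h by (simp add: power_divide)
    moreover have "1 \<le> (W / real h) ^ (h - k)" using Wh by (rule one_le_power)
    ultimately have "real (V choose k) * 1 \<le> real (V choose k) * ((W / real h) ^ h * (real h / W) ^ k)"
      by (intro mult_left_mono) auto
    then show "real (V choose k) \<le> (W / real h) ^ h * (real (V choose k) * (real h / W) ^ k)"
      by (simp add: mult_ac)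
  qed
  also have "\<dots> = (W / real h) ^ h * (\<Sum>k\<le>h. real (V choose k) * (real h / W) ^ k)"
    by (simp add: sum_distrib_left)
  finally have card: "real (card {Y. Y \<subseteq> B \<and> card Y \<le> h})
      \<le> (W / real h) ^ h * (\<Sum>k\<le>h. real (V choose k) * (real h / W) ^ k)" .
  \<comment> \<open>The upper limit \<open>h + V\<close> covers both \<open>h \<le> V\<close> and
    \<open>V < h\<close>; terms with \<open>k > V\<close> vanish.\<close>
  have "(\<Sum>k\<le>h. real (V choose k) * (real h / W) ^ k) \<le> (\<Sum>k\<le>h + V. real (V choose k) * (real h / W) ^ k)"
    using W0 by (intro sum_mono2) auto
  also have "\<dots> = (\<Sum>k\<le>V. real (V choose k) * (real h / W) ^ k)"
    by (intro sum.mono_neutral_right) (auto simp: not_le)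
  also have "\<dots> = (real h / W + 1) ^ V" by (simp add: binomial_ring)
  also have "\<dots> \<le> exp (real h / W) ^ V"
    using W0 exp_ge_add_one_self[of "real h / W"] by (intro power_mono) (auto simp: add.commute)
  also have "\<dots> = exp (real h * (real V / W))" by (simp flip: exp_of_nat_mult add: mult_ac)
  also have "\<dots> \<le> exp (real h * 1)"
    using B W0 unfolding exp_le_cancel_iff by (intro mult_left_mono) (auto simp: V_def)
  also have "\<dots> = exp 1 ^ h" by (simp flip: exp_of_nat_mult)
  finally have "(W / real h) ^ h * (\<Sum>k\<le>h. real (V choose k) * (real h / W) ^ k)
      \<le> (W / real h) ^ h * exp 1 ^ h"
    using W0 by (intro mult_left_mono) auto
  also have "\<dots> = (exp 1 * W / real h) ^ h"
    by (simp add: power_mult_distrib power_divide)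
  finally show ?thesis using card by linarith
qed

text \<open>A nonempty cluster lies in the ball of radius \<open>l\<close> around any of its points;
  the factor \<open>CARD('a) ^ n\<close> counts the centres.\<close>

lemma card_clusters_le:
  fixes W :: real
  assumes W: "\<And>x :: 'a::finite list. length x = n \<Longrightarrow> real (card (hamming_ball x l)) \<le> W"
    and h: "0 < h" "real h \<le> W"
  shows "real (card (clusters n h l :: 'a list set set)) \<le> real CARD('a) ^ n * (exp 1 * W / real h) ^ h"
proof -
  define S where "S x = {Y. Y \<subseteq> hamming_ball x l \<and> card Y \<le> h}" for x :: "'a list"
  have fS: "finite (S x)" for x
    by (rule finite_subset[of _ "Pow (hamming_ball x l)"]) (auto simp: S_def)
  have "clusters n h l \<subseteq> (\<Union>x\<in>words n. S x)"
  proof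
    fix X :: "'a list set" assume X: "X \<in> clusters n h l"
    show "X \<in> (\<Union>x\<in>words n. S x)"
    proof (cases "X = {}")
      \<comment> \<open>The empty cluster has no point of its own, so an arbitrary word serves as
        centre.\<close>
      case True
      moreover have "replicate n undefined \<in> words n" by (simp add: words_def)
      ultimately show ?thesis by (auto simp: S_def)
    next
      case False
      then obtain x where "x \<in> X" by blast
      then have "x \<in> words n" "X \<in> S x"
        using X by (auto simp: S_def clusters_def hamming_ball_def words_def)
      then show ?thesis by blast
    qed
  qed
  then have "card (clusters n h l :: 'a list set set) \<le> card (\<Union>x\<in>(words n :: 'a list set). S x)"
    using fS by (intro card_mono) auto
  also have "\<dots> \<le> (\<Sum>x\<in>(words n :: 'a list set). card (S x))" by (rule card_UN_le) simp
  finally have "real (card (clusters n h l :: 'a list set set)) \<le> (\<Sum>x\<in>(words n :: 'a list set). real (card (S x)))"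
    by (simp flip: of_nat_sum)
  also have "\<dots> \<le> (\<Sum>x\<in>(words n :: 'a list set). (exp 1 * W / real h) ^ h)"
    unfolding S_def using W h by (intro sum_mono card_subsets_le) (auto simp: words_def)
  also have "\<dots> = real CARD('a) ^ n * (exp 1 * W / real h) ^ h" by (simp add: card_words)
  finally show ?thesis .
qed

section \<open>The clique behind the lower bound\<close>

text \<open>Blocks are peeled off one by one; a block has fewer than \<open>h\<close> elements only
  if nothing remains after it.\<close>

lemma split_into_blocks:
  assumes "finite A" "card A \<le> t * h"
  shows "\<exists>X. A = (\<Union>i<t. X i) \<and> (\<forall>i<t. finite (X i) \<and> card (X i) \<le> h)"
  using assms
proof (induction t arbitrary: A)
  case 0
  then show ?case by simp
next
  case (Suc t)
  obtain B where B: "B \<subseteq> A" "card B = min h (card A)" "finite B"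
    using obtain_subset_with_card_n[of "min h (card A)" A] by auto
  have "card (A - B) = card A - min h (card A)"
    using B by (simp add: card_Diff_subset)
  then have "card (A - B) \<le> t * h" using Suc.prems by simp
  then obtain X where X: "A - B = (\<Union>i<t. X i)" "\<forall>i<t. finite (X i) \<and> card (X i) \<le> h"
    using Suc.IH[of "A - B"] Suc.prems by auto
  have "A = (\<Union>i<Suc t. (X(t := B)) i)"
    using X(1) B(1) by (auto simp: lessThan_Suc)
  moreover have "\<forall>i<Suc t. finite ((X(t := B)) i) \<and> card ((X(t := B)) i) \<le> h"
    using X(2) B by (auto simp: less_Suc_eq)
  ultimately show ?case by blast
qed

text \<open>The ball of radius \<open>l div 2\<close> has diameter at most \<open>l\<close>, so any
  cutting of a subset of size \<open>t * h\<close> into \<open>t\<close> blocks of size at most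
  \<open>h\<close> is admissible.\<close>

lemma choose_le_chromatic_number:
  fixes x :: "'a::finite list"
  assumes "length x = n" "0 < t" "0 < h"
  shows "card (hamming_ball x (l div 2)) choose (t * h)
    \<le> chromatic_number (graph_square (thl_graph n t h l :: 'a list set graph))"
proof -
  let ?G = "thl_graph n t h l :: 'a list set graph"
  let ?B = "hamming_ball x (l div 2)"
  define F where "F = {A. A \<subseteq> ?B \<and> card A = t * h}"
  have ball: "?B \<subseteq> words n" using assms by (auto simp: hamming_ball_def)
  have diam: "hamming_dist u w \<le> l" if "u \<in> ?B" "w \<in> ?B" for u w
    using that hamming_dist_triangle[of u x w] by (auto simp: hamming_ball_def words_def)
  have edge: "({}, A) \<in> snd ?G \<and> (A, {}) \<in> snd ?G" if A: "A \<in> F" for A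
  proof -
    have "finite A" using A by (auto simp: F_def intro: finite_subset)
    then obtain X where X: "A = (\<Union>i<t. X i)" "\<forall>i<t. finite (X i) \<and> card (X i) \<le> h"
      using A split_into_blocks[of A t h] by (auto simp: F_def)
    have "\<forall>i<t. \<forall>u\<in>X i. \<forall>w\<in>X i. hamming_dist u w \<le> l"
      using A X(1) diam by (auto simp: F_def)
    then have "thl_sets t h l {} A"
      unfolding thl_sets_def using X by (intro exI[of _ t] exI[of _ X]) auto
    \<comment> \<open>Edges join distinct vertices; here \<open>t * h > 0\<close> enters.\<close>
    moreover have "A \<noteq> {}" using A assms by (auto simp: F_def)
    ultimately show ?thesis
      using A ball by (auto simp: thl_graph_def F_def thl_sets_commute[of t h l A])
  qed
  obtain c where c: "proper_colouring (graph_square ?G) ((card (thl_differences n t h l :: 'a list set set))\<^sup>2) c"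
    using square_thl_graph_colouring by blast
  have FV: "F \<subseteq> fst ?G" using ball by (auto simp: F_def thl_graph_def)
  have "card F \<le> chromatic_number (graph_square ?G)"
  proof (rule clique_le_chromatic_number[OF c])
    show "F \<subseteq> fst (graph_square ?G)" using FV by (simp add: graph_square_def)
    fix A B assume AB: "A \<in> F" "B \<in> F" "A \<noteq> B"
    \<comment> \<open>The walk of length 2 passes through the empty set.\<close>
    have "(A, B) \<in> snd ?G O snd ?G" using edge AB by blast
    then show "(A, B) \<in> snd (graph_square ?G)"
      using AB FV graph_square_iff[of A ?G B] by blast
  qed
  then show ?thesis by (simp add: F_def n_subsets)
qed

lemma chromatic_number_pos:
  "0 < chromatic_number (graph_square (thl_graph n t h l :: 'a::finite list set graph))"
proof -
  obtain c where c: "proper_colouring (graph_square (thl_graph n t h l :: 'a list set graph))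
    ((card (thl_differences n t h l :: 'a list set set))\<^sup>2) c"
    using square_thl_graph_colouring by blast
  have "card {{} :: 'a list set} \<le> chromatic_number (graph_square (thl_graph n t h l :: 'a list set graph))"
    by (rule clique_le_chromatic_number[OF c]) (auto simp: graph_square_def thl_graph_def)
  then show ?thesis by simp
qed

section \<open>Explicit bounds for the logarithm of the chromatic number\<close>

text \<open>Combines \<open>(V / k) ^ k \<le> V choose k\<close> for \<open>k = t * h\<close> with
  the entropy bound for \<open>V\<close>. The correction term is free of \<open>h\<close> and
  \<open>l\<close>, so for fixed \<open>t\<close> it vanishes as \<open>n\<close> grows.\<close>

lemma log_chromatic_number_ge:
  fixes \<delta> :: real and q :: nat
  assumes q: "CARD('a::finite) = q" "2 \<le> q" and pos: "0 < t" "0 < n" "0 < h"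
    and lam: "0 < \<delta>" "\<delta> \<le> real l / real n" "real l / real n \<le> 1"
  shows "log q (chromatic_number (graph_square (thl_graph n t h l :: 'a list set graph)))
      / (real t * real n * real h)
    \<ge> qary_entropy q (real l / real n / 2) - log q h / real n
        + (log q (\<delta> / (2 * real q)) - log q t - log q (real n + 1)) / real n"
proof -
  define \<chi> where "\<chi> = chromatic_number (graph_square (thl_graph n t h l :: 'a list set graph))"
  define p where "p = real l / (2 * real n)"
  define k where "k = t * h"
  define x :: "'a list" where "x = replicate n undefined"
  define V where "V = card (hamming_ball x (l div 2))"
  have x: "length x = n" by (simp add: x_def)
  have k: "0 < k" using pos by (simp add: k_def)
  have "p = real l / real n / 2" by (simp add: p_def)
  then have p: "\<delta> / 2 \<le> p" "0 < p" "p \<le> 1 / 2" "real l / real n / 2 = p" using lam by simp_all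
  have "x \<in> hamming_ball x (l div 2)"
    by (simp add: hamming_ball_def words_def hamming_dist_def)
  then have V0: "0 < V" unfolding V_def by (subst card_gt_0_iff) auto
  have "(real V / real k) ^ k \<le> real \<chi>"
  proof (cases "k \<le> V")
    case True
    have "(real V / real k) ^ k \<le> real (V choose k)" using True by (rule binomial_ge_n_over_k_pow_k)
    also have "\<dots> \<le> real \<chi>"
      using choose_le_chromatic_number[OF x pos(1,3), of l] by (simp add: V_def k_def \<chi>_def)
    finally show ?thesis .
  next
    \<comment> \<open>For \<open>V < k\<close> the clique is empty, but then the left side is at
      most 1.\<close>
    case False
    then have "(real V / real k) ^ k \<le> 1" by (intro power_le_one) auto
    also have "\<dots> \<le> real \<chi>" using chromatic_number_pos[where 'a='a, of n t h l] by (simp add: \<chi>_def)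
    finally show ?thesis .
  qed
  then have "log q ((real V / real k) ^ k) \<le> log q \<chi>"
    using q V0 k by (intro log_mono) auto
  then have "real k * (log q V - log q k) \<le> log q \<chi>"
    using q V0 k by (simp add: log_nat_power log_divide)
  moreover have "real k * (real n * qary_entropy q p + log q (p / q) - log q (real n + 1) - log q k)
      \<le> real k * (log q V - log q k)"
    using log_card_hamming_ball_ge[OF _ _ x pos(2) p_def p(2,3), of q] q k by (simp add: V_def)
  \<comment> \<open>The bound \<open>p \<ge> \<delta> / 2\<close> removes \<open>l\<close> from the
    correction term.\<close>
  moreover have "real k * (real n * qary_entropy q p + log q (\<delta> / (2 * q)) - log q (real n + 1) - log q k)
      \<le> real k * (real n * qary_entropy q p + log q (p / q) - log q (real n + 1) - log q k)"
  proof -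
    have "log q (\<delta> / (2 * q)) \<le> log q (p / q)"
      using p lam q by (intro log_mono) (auto simp: field_simps)
    then show ?thesis by (intro mult_left_mono) auto
  qed
  ultimately have *: "real k * (real n * qary_entropy q p + log q (\<delta> / (2 * q)) - log q (real n + 1) - log q k)
      \<le> log q \<chi>" by linarith
  have logk: "log q k = log q t + log q h" using q pos by (simp add: k_def log_mult)
  have "qary_entropy q p - log q h / real n + (log q (\<delta> / (2 * real q)) - log q t - log q (real n + 1)) / real n
      = real k * (real n * qary_entropy q p + log q (\<delta> / (2 * q)) - log q (real n + 1) - log q k)
        / (real t * real n * real h)"
    unfolding logk using pos by (simp add: k_def field_simps)
  also have "\<dots> \<le> log q \<chi> / (real t * real n * real h)"
    using * by (intro divide_right_mono) auto
  finally show ?thesis unfolding p(4) \<chi>_def .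
qed

text \<open>After taking logarithms, the \<open>q ^ n\<close> centres contribute
  \<open>2 / h\<close> and the factor \<open>exp 1\<close> contributes
  \<open>2 * log q (exp 1) / n\<close>; the exponent \<open>t\<close> cancels, so the correction is
  uniform in \<open>t\<close>.\<close>

lemma log_chromatic_number_le:
  fixes q :: nat
  assumes q: "CARD('a::finite) = q" "2 \<le> q" and pos: "0 < t" "0 < n" "0 < h" "0 < l"
    and lam: "real l / real n \<le> 1 - 1 / real q"
    and eta: "log q h / real n \<le> qary_entropy q (real l / real n)"
  shows "log q (chromatic_number (graph_square (thl_graph n t h l :: 'a list set graph)))
      / (real t * real n * real h)
    \<le> 2 * (qary_entropy q (real l / real n) - log q h / real n)
        + (2 / real h + 2 * log q (exp 1) / real n)"
proof -
  define \<chi> where "\<chi> = chromatic_number (graph_square (thl_graph n t h l :: 'a list set graph))"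
  define H where "H = qary_entropy q (real l / real n)"
  define W where "W = real q powr (real n * H)"
  define c where "c = card (clusters n h l :: 'a list set set)"
  have W0: "0 < W" using q by (simp add: W_def)
  have "real (card (hamming_ball x l)) \<le> W" if "length x = n" for x :: "'a list"
    unfolding W_def H_def using q pos lam that by (intro card_hamming_ball_le) auto
  \<comment> \<open>This is \<open>eta\<close> exponentiated, in the form that the count of subsets
    asks for.\<close>
  moreover have "real h \<le> W"
  proof -
    have "log q h \<le> real n * H" using eta pos by (simp add: H_def field_simps)
    then have "real q powr log q h \<le> W"
      using q unfolding W_def by (intro powr_mono) auto
    then show ?thesis using q pos by simp
  qed
  ultimately have "real c \<le> real q ^ n * (exp 1 * W / real h) ^ h"
    using card_clusters_le[where 'a='a, of n l W h] pos q(1) by (simp add: c_def)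
  moreover have \<chi>: "0 < \<chi>" unfolding \<chi>_def by (rule chromatic_number_pos)
  \<comment> \<open>The square comes from two steps in the graph, the exponent \<open>t\<close> from
    the number of clusters.\<close>
  have "\<chi> \<le> (c ^ t)\<^sup>2"
  proof -
    obtain f where "proper_colouring (graph_square (thl_graph n t h l :: 'a list set graph))
        ((card (thl_differences n t h l :: 'a list set set))\<^sup>2) f"
      using square_thl_graph_colouring by blast
    then have "\<chi> \<le> (card (thl_differences n t h l :: 'a list set set))\<^sup>2"
      unfolding \<chi>_def by (rule chromatic_number_le)
    also have "\<dots> \<le> (c ^ t)\<^sup>2"
      unfolding c_def by (intro power_mono card_thl_differences_le) auto
    finally show ?thesis .
  qed
  then have "real \<chi> \<le> real c ^ (2 * t)"
    by (simp flip: of_nat_power add: power_mult mult.commute)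
  ultimately have "real \<chi> \<le> (real q ^ n * (exp 1 * W / real h) ^ h) ^ (2 * t)"
    by (meson order.trans power_mono of_nat_0_le_iff)
  then have "log q \<chi> \<le> log q ((real q ^ n * (exp 1 * W / real h) ^ h) ^ (2 * t))"
    using q \<chi> by (intro log_mono) auto
  also have "\<dots> = 2 * real t * (real n + real h * (log q (exp 1) + real n * H - log q h))"
    using q pos W0 by (simp add: log_nat_power log_mult log_divide W_def)
  finally have "log q \<chi> / (real t * real n * real h)
      \<le> 2 * real t * (real n + real h * (log q (exp 1) + real n * H - log q h)) / (real t * real n * real h)"
    by (intro divide_right_mono) auto
  also have "\<dots> = 2 * (H - log q h / real n) + (2 / real h + 2 * log q (exp 1) / real n)"
    using pos by (simp add: field_simps)
  finally show ?thesis by (simp add: \<chi>_def H_def)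
qed

section \<open>Passage to the limit\<close>

text \<open>The product filter lets \<open>n\<close> and \<open>h\<close> tend to infinity
  independently; each summand is a null sequence composed with a projection.\<close>

lemma smallo_1_prodI:
  fixes f g :: "nat \<Rightarrow> real"
  assumes "f \<longlonglongrightarrow> 0" "g \<longlonglongrightarrow> 0"
  shows "(\<lambda>(n, h). f n + g h) \<in> o[at_top \<times>\<^sub>F at_top](\<lambda>_. 1)"
proof -
  have "((\<lambda>x :: nat \<times> nat. f (fst x) + g (snd x)) \<longlongrightarrow> 0 + 0) (at_top \<times>\<^sub>F at_top)"
    using assms
    by (intro tendsto_add filterlim_compose[of f _ at_top fst] filterlim_compose[of g _ at_top snd])
      (simp_all add: filterlim_def filtermap_fst_prod_filter filtermap_snd_prod_filter)
  then show ?thesis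
    by (intro smalloI_tendsto) (simp_all add: case_prod_unfold)
qed

text \<open>Squeezed between 0 and the bound that \<open>n + 1 \<le> 2 n\<close> gives.\<close>

lemma lim_ln_Suc_over_n: "(\<lambda>n. ln (real n + 1) / real n) \<longlonglongrightarrow> 0"
proof (rule tendsto_sandwich[OF _ _ tendsto_const])
  show "(\<lambda>n. ln 2 / real n + ln (real n) / real n) \<longlonglongrightarrow> 0"
    using tendsto_add[OF lim_const_over_n[of "ln 2 :: real"]
        filterlim_compose[OF ln_x_over_x_tendsto_0 filterlim_real_sequentially]] by simp
  show "\<forall>\<^sub>F n in sequentially. ln (real n + 1) / real n \<le> ln 2 / real n + ln (real n) / real n"
  proof (rule eventually_sequentiallyI[of 1])
    fix n :: nat
    assume n: "1 \<le> n"
    then have "ln (real n + 1) \<le> ln (2 * real n)" by simp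
    also have "\<dots> = ln 2 + ln (real n)" using n by (simp add: ln_mult)
    finally have "ln (real n + 1) / real n \<le> (ln 2 + ln (real n)) / real n"
      by (rule divide_right_mono) simp
    then show "ln (real n + 1) / real n \<le> ln 2 / real n + ln (real n) / real n"
      by (simp add: add_divide_distrib)
  qed
qed auto

theorem theorem3:
  fixes q m :: nat and \<delta> :: real
  assumes "CARD('a::{field,finite}) = q" and "q = 2 ^ m" and "m > 0"
    and "\<delta> > 0"
  shows "(\<forall>t>0. \<exists>e :: nat \<times> nat \<Rightarrow> real.
            e \<in> o[at_top \<times>\<^sub>F at_top](\<lambda>_. 1) \<and>
            (\<forall>n>0. \<forall>h>0. \<forall>l>0.
               let lam = real l / real n; \<eta> = log q h / real n in
               \<delta> \<le> lam \<and> lam \<le> 1 - 1 / real q - \<delta> \<longrightarrow>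
               log q (chromatic_number (graph_square (thl_graph n t h l :: 'a list set graph)))
                 / (real t * real n * real h)
               \<ge> qary_entropy q (lam / 2) - \<eta> + e (n, h)))
       \<and> (\<forall>\<epsilon>>0. \<exists>e :: nat \<times> nat \<Rightarrow> real.
            e \<in> o[at_top \<times>\<^sub>F at_top](\<lambda>_. 1) \<and>
            (\<forall>t>0. \<forall>n>0. \<forall>h>0. \<forall>l>0.
               let lam = real l / real n; \<eta> = log q h / real n in
               \<delta> \<le> lam \<and> lam \<le> 1 - 1 / real q - \<delta> \<and>
               \<eta> < qary_entropy q lam - \<epsilon> \<longrightarrow>
               log q (chromatic_number (graph_square (thl_graph n t h l :: 'a list set graph)))
                 / (real t * real n * real h)
               \<le> 2 * (qary_entropy q lam - \<eta>) + e (n, h)))"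
proof -
  have q2: "2 \<le> q"
    using assms(2,3) self_le_power[of "2::nat" m] by simp
  show ?thesis
  proof (intro conjI allI impI)
    fix t :: nat
    assume t: "0 < t"
    \<comment> \<open>This error depends on \<open>t\<close>, which is fixed before \<open>e\<close>
      is chosen.\<close>
    define f where "f n = (log q (\<delta> / (2 * real q)) - log q t - log q (real n + 1)) / real n" for n
    have "(\<lambda>n. (log q (\<delta> / (2 * real q)) - log q t) / real n - ln (real n + 1) / real n / ln q) \<longlonglongrightarrow> 0 - 0 / ln q"
      using q2 by (intro tendsto_diff tendsto_divide tendsto_const lim_const_over_n lim_ln_Suc_over_n) simp
    then have "f \<longlonglongrightarrow> 0"
      unfolding f_def log_def[of _ "real _ + 1"] by (simp add: diff_divide_distrib mult.commute)
    then have "(\<lambda>(n, h). f n + 0) \<in> o[at_top \<times>\<^sub>F at_top](\<lambda>_ :: nat \<times> nat. 1)"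
      by (rule smallo_1_prodI) simp
    moreover have "qary_entropy q (real l / real n / 2) - log q h / real n + (f n + 0)
        \<le> log q (chromatic_number (graph_square (thl_graph n t h l :: 'a list set graph)))
          / (real t * real n * real h)"
      if "0 < n" "0 < h" "\<delta> \<le> real l / real n" "real l / real n \<le> 1 - 1 / real q - \<delta>" for n h l
    proof -
      \<comment> \<open>With \<open>\<lambda> \<le> 1\<close> the argument
        \<open>\<lambda> / 2\<close> stays at most 1/2.\<close>
      have "0 \<le> 1 / real q" by simp
      then have "real l / real n \<le> 1" using that(4) assms(4) by linarith
      then show ?thesis
        unfolding f_def add_0_right using assms(1,4) q2 t that by (intro log_chromatic_number_ge)
    qed
    ultimately show "\<exists>e :: nat \<times> nat \<Rightarrow> real.
            e \<in> o[at_top \<times>\<^sub>F at_top](\<lambda>_. 1) \<and>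
            (\<forall>n>0. \<forall>h>0. \<forall>l>0.
               let lam = real l / real n; \<eta> = log q h / real n in
               \<delta> \<le> lam \<and> lam \<le> 1 - 1 / real q - \<delta> \<longrightarrow>
               log q (chromatic_number (graph_square (thl_graph n t h l :: 'a list set graph)))
                 / (real t * real n * real h)
               \<ge> qary_entropy q (lam / 2) - \<eta> + e (n, h))"
      unfolding Let_def by (intro exI[of _ "\<lambda>(n, h). f n + 0"]) auto
  next
    fix \<epsilon> :: real
    assume \<epsilon>: "0 < \<epsilon>"
    \<comment> \<open>Here \<open>e\<close> is chosen before \<open>t\<close>, so the error has to
      be free of \<open>t\<close>.\<close>
    define f where "f n = 2 * log q (exp 1) / real n" for n
    define g where "g h = 2 / real h" for h
    have "f \<longlonglongrightarrow> 0" "g \<longlonglongrightarrow> 0" unfolding f_def g_def by (intro lim_const_over_n)+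
    then have "(\<lambda>(n, h). f n + g h) \<in> o[at_top \<times>\<^sub>F at_top](\<lambda>_ :: nat \<times> nat. 1)"
      by (rule smallo_1_prodI)
    moreover have "log q (chromatic_number (graph_square (thl_graph n t h l :: 'a list set graph)))
          / (real t * real n * real h)
        \<le> 2 * (qary_entropy q (real l / real n) - log q h / real n) + (f n + g h)"
      if "0 < t" "0 < n" "0 < h" "0 < l" "real l / real n \<le> 1 - 1 / real q - \<delta>"
        "log q h / real n < qary_entropy q (real l / real n) - \<epsilon>" for t n h l
      using log_chromatic_number_le[OF assms(1) q2 that(1-4)] that(5,6) assms(4) \<epsilon>
      unfolding f_def g_def by linarith
    ultimately show "\<exists>e :: nat \<times> nat \<Rightarrow> real.
            e \<in> o[at_top \<times>\<^sub>F at_top](\<lambda>_. 1) \<and>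
            (\<forall>t>0. \<forall>n>0. \<forall>h>0. \<forall>l>0.
               let lam = real l / real n; \<eta> = log q h / real n in
               \<delta> \<le> lam \<and> lam \<le> 1 - 1 / real q - \<delta> \<and>
               \<eta> < qary_entropy q lam - \<epsilon> \<longrightarrow>
               log q (chromatic_number (graph_square (thl_graph n t h l :: 'a list set graph)))
                 / (real t * real n * real h)
               \<le> 2 * (qary_entropy q lam - \<eta>) + e (n, h))"
      unfolding Let_def by (intro exI[of _ "\<lambda>(n, h). f n + g h"]) auto
  qed
qed

end
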